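(* Let $k\ge 5$ be an integer. Then \[\gamma^{SID}(C_{2k}(1,k))=\begin{cases}\left\lceil\frac{4k}{3}\right\rceil & \text{if } k\equiv 0,1\pmod 3,\\ \left\lceil\frac{4k}{3}\right\rceil+1 & \text{if } k\equiv 2\pmod 3.\end{cases}\]
   Context: All graphs are simple and undirected. For a graph $G=(V,E)$ and $u\in V$, $N[u]=\{u\}\cup\{v: uv\in E\}$. A code is a nonempty $C\subseteq V$, and $I(C;u)=N[u]\cap C$. $C$ is self-identifying if $I(C;u)\setminus I(C;v)\neq\emptyset$ for all distinct $u,v\in V$. $\gamma^{SID}(G)$ is the minimum cardinality of a self-identifying code in a finite graph $G$. The circulant graph $C_{2k}(1,k)$ has vertex set $\mathbb{Z}_{2k}$, and the open neighbourhood of $u$ is $\{u-1,u+1,u+k\}$ modulo $2k$ (note $u-k\equiv u+k$). *)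

theory Defs
  imports Complex_Main "Graph_Theory.Pair_Digraph"
begin

text \<open>
  A finite simple undirected graph is an instance of the locale \<open>pair_graph\<close>: an edge \<open>uv\<close> is
  represented by the two arcs \<open>(u, v)\<close> and \<open>(v, u)\<close>.
\<close>

definition closed_nbhd :: "'a pair_pre_digraph \<Rightarrow> 'a \<Rightarrow> 'a set" where
  "closed_nbhd G u = {u} \<union> {v. (u, v) \<in> parcs G}"

definition is_code :: "'a pair_pre_digraph \<Rightarrow> 'a set \<Rightarrow> bool" where
  "is_code G C \<longleftrightarrow> C \<noteq> {} \<and> C \<subseteq> pverts G"

definition I_set :: "'a pair_pre_digraph \<Rightarrow> 'a set \<Rightarrow> 'a \<Rightarrow> 'a set" where
  "I_set G C u = closed_nbhd G u \<inter> C"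

definition self_identifying :: "'a pair_pre_digraph \<Rightarrow> 'a set \<Rightarrow> bool" where
  "self_identifying G C \<longleftrightarrow> is_code G C \<and>
     (\<forall>u\<in>pverts G. \<forall>v\<in>pverts G. u \<noteq> v \<longrightarrow> I_set G C u - I_set G C v \<noteq> {})"

text \<open>
  The value is meaningful only for finite graphs that admit a self-identifying code; otherwise it
  is the minimum of an empty set (unspecified), or involves cardinalities of infinite sets.
\<close>

definition gamma_SID :: "'a pair_pre_digraph \<Rightarrow> nat" where
  "gamma_SID G = Min {card C | C. self_identifying G C}"

text \<open>\<open>circulant_1k k\<close> is \<open>C\<^bsub>2k\<^esub>(1,k)\<close>, with \<open>\<int>\<^bsub>2k\<^esub>\<close> represented by the residues \<open>0, \<dots>, 2k - 1\<close>.\<close>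

definition circulant_1k :: "nat \<Rightarrow> int pair_pre_digraph" where
  "circulant_1k k =
    \<lparr> pverts = {0..<2 * int k},
      parcs = {(u, v). u \<in> {0..<2 * int k} \<and>
        v \<in> {(u - 1) mod (2 * int k), (u + 1) mod (2 * int k), (u + int k) mod (2 * int k)}} \<rparr>"

lemma pair_graph_circulant_1k:
  assumes "k \<ge> 1"
  shows "pair_graph (circulant_1k k)"
proof -
  define n where "n = 2 * int k"
  define V where "V = {0..<n}"
  have n: "n \<ge> 2" using assms by (simp add: n_def)
  have G: "pverts (circulant_1k k) = V"
    "\<And>u v. (u, v) \<in> parcs (circulant_1k k) \<longleftrightarrow>
       u \<in> V \<and> v \<in> {(u - 1) mod n, (u + 1) mod n, (u + int k) mod n}"
    by (auto simp: circulant_1k_def V_def n_def)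
  have wf: "u \<in> V \<and> v \<in> V" if "(u, v) \<in> parcs (circulant_1k k)" for u v
    using that n unfolding G by (auto simp: V_def)
  have rep: "u mod n = u" if "u \<in> V" for u
    using that by (simp add: V_def)
  have loop: "u \<noteq> v" if "(u, v) \<in> parcs (circulant_1k k)" for u v
  proof
    assume "u = v"
    then have "u mod n = (u - 1) mod n \<or> u mod n = (u + 1) mod n \<or> u mod n = (u + int k) mod n"
      using that rep[of u] unfolding G by auto
    then have "n dvd 1 \<or> n dvd int k"
      by (auto simp: mod_eq_dvd_iff dvd_minus_iff)
    moreover have "\<not> n dvd 1" using n by (auto dest: zdvd_imp_le)
    moreover have "\<not> n dvd int k" using n by (auto simp: n_def dest: zdvd_imp_le)
    ultimately show False by blast
  qed
  have symm: "(v, u) \<in> parcs (circulant_1k k)" if uv: "(u, v) \<in> parcs (circulant_1k k)" for u v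
  proof -
    have u: "u \<in> V" and v: "v \<in> V" using wf[OF uv] by auto
    consider "v = (u - 1) mod n" | "v = (u + 1) mod n" | "v = (u + int k) mod n"
      using uv unfolding G by auto
    then have "u \<in> {(v - 1) mod n, (v + 1) mod n, (v + int k) mod n}"
    proof cases
      case 1
      then have "(v + 1) mod n = u mod n" by (simp add: mod_simps)
      then show ?thesis using rep[OF u] by auto
    next
      case 2
      then have "(v - 1) mod n = u mod n" by (simp add: mod_simps)
      then show ?thesis using rep[OF u] by auto
    next
      case 3
      then have "(v + int k) mod n = (u + n) mod n"
        by (simp add: mod_simps n_def add.assoc)
      then show ?thesis using rep[OF u] by auto
    qed
    with v show ?thesis unfolding G by blast
  qed
  have "finite V" by (simp add: V_def)
  moreover have "parcs (circulant_1k k) \<subseteq> V \<times> V" using wf by auto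
  ultimately have fin: "finite (parcs (circulant_1k k))"
    by (meson finite_SigmaI finite_subset)
  have "sym (parcs (circulant_1k k))" using symm by (auto intro: symI)
  then have "symmetric (with_proj (circulant_1k k))"
    by (simp add: symmetric_def arcs_ends_def arc_to_ends_def)
  moreover have "fst e \<in> V" "snd e \<in> V" "fst e \<noteq> snd e" if "e \<in> parcs (circulant_1k k)" for e
    using that wf[of "fst e" "snd e"] loop[of "fst e" "snd e"] by auto
  ultimately show ?thesis
    using fin \<open>finite V\<close> by unfold_locales (simp_all add: G(1))
qed

end

theory Submission
  imports Defs
begin

text \<open>
  A set \<open>C\<close> is self-identifying in \<open>C\<^bsub>2k\<^esub>(1,k)\<close> iff no two elements of its complement \<open>D\<close> differ by
  \<open>1\<close>, \<open>2\<close> or \<open>k + 1\<close> modulo \<open>2k\<close>, so the task is to maximise \<open>|D|\<close>; the maximum is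
  \<open>2 \<lfloor>k/3\<rfloor>\<close>. It is attained by the vertices congruent to \<open>0, 3, \<dots>, 3 \<lfloor>k/3\<rfloor> - 3\<close> modulo \<open>k\<close>. Three
  consecutive vertices contain at most one element of \<open>D\<close>, whence \<open>|D| \<le> \<lfloor>2k/3\<rfloor>\<close>, which suffices
  unless \<open>k = 3m + 2\<close>. In that case assume \<open>|D| = 2m + 1\<close>. If some window of three consecutive
  vertices misses \<open>D\<close>, then cutting the cycle there and counting forces \<open>D\<close> to be an arithmetic
  progression \<open>x, x + 3, \<dots>, x + 6m\<close>; if not, \<open>D\<close> is closed under adding \<open>3\<close>. Either way \<open>D\<close>
  contains two elements at distance \<open>3(m + 1) = k + 1\<close>.
\<close>

text \<open>The predicate \<open>P\<close> is the complement \<open>D\<close> lifted to a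
  \<open>2 * k\<close>-periodic predicate on all integers, so that windows may run across
  \<open>0\<close>. A difference of \<open>k - 1\<close> is covered too, since it is
  \<open>-(k + 1)\<close> modulo \<open>2 * k\<close>.\<close>

definition spread :: "int \<Rightarrow> (int \<Rightarrow> bool) \<Rightarrow> bool" where
  "spread k P \<longleftrightarrow> (\<forall>x. P (x + 2 * k) = P x) \<and>
     (\<forall>x. P x \<longrightarrow> \<not> P (x + 1) \<and> \<not> P (x + 2) \<and> \<not> P (x + k + 1))"

subsection \<open>Self-identifying codes of the circulant graph\<close>

text \<open>Turns congruences between nearby representatives into equations that linear arithmetic
  can decide.\<close>

lemma dvd_small_int:
  fixes n z :: int
  assumes "n dvd z" "\<bar>z\<bar> < 2 * n"
  shows "z = 0 \<or> z = n \<or> z = - n"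
proof -
  from assms(1) obtain q where q: "z = n * q" by (elim dvdE)
  have n: "n > 0" using assms(2) by linarith
  have "n * \<bar>q\<bar> < n * 2" using assms(2) n by (simp add: q abs_mult mult.commute)
  then have "\<bar>q\<bar> < 2" using n by simp
  then have "q = 0 \<or> q = 1 \<or> q = -1" by linarith
  then show ?thesis using q by auto
qed

lemma closed_nbhd_circulant_1k:
  assumes "u \<in> {0..<2 * int k}"
  shows "closed_nbhd (circulant_1k k) u = (\<lambda>e. (u + e) mod (2 * int k)) ` {0, -1, 1, int k}"
  using assms by (auto simp: closed_nbhd_def circulant_1k_def)

lemma I_set_diff_empty_iff:
  assumes "u \<in> {0..<2 * int k}" "v \<in> {0..<2 * int k}"
  shows "I_set (circulant_1k k) C u - I_set (circulant_1k k) C v = {} \<longleftrightarrow>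
    (\<forall>e\<in>{0, -1, 1, int k}. (u + e) mod (2 * int k) \<in> C \<longrightarrow>
       (\<exists>f\<in>{0, -1, 1, int k}. 2 * int k dvd (u + e) - (v + f)))"
  unfolding I_set_def closed_nbhd_circulant_1k[OF assms(1)] closed_nbhd_circulant_1k[OF assms(2)]
    mod_eq_dvd_iff[symmetric]
  by blast

lemma self_identifying_imp_spread:
  assumes k: "k \<ge> 2" and si: "self_identifying (circulant_1k k) C"
  shows "spread (int k) (\<lambda>x. x mod (2 * int k) \<notin> C)"
proof -
  define n where "n = 2 * int k"
  have n: "n > 0" using k by (simp add: n_def)
  have V: "pverts (circulant_1k k) = {0..<n}" by (simp add: circulant_1k_def n_def)
  \<comment> \<open>Self-identification for the pair \<open>x\<close>, \<open>x + d\<close> with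
    arbitrary integer representatives: some codeword in the closed neighbourhood of \<open>x\<close>
    avoids that of \<open>x + d\<close>.\<close>
  have key: "\<exists>e\<in>{0, -1, 1, int k}. (x + e) mod n \<in> C \<and> (\<forall>f\<in>{0, -1, 1, int k}. \<not> n dvd e - d - f)"
    if d: "\<not> n dvd d" for x d
  proof -
    define u v where "u = x mod n" and "v = (x + d) mod n"
    have uv: "u \<in> {0..<n}" "v \<in> {0..<n}" using n by (auto simp: u_def v_def)
    have "u \<noteq> v"
    proof
      assume "u = v"
      then have "n dvd x + d - x" unfolding u_def v_def by (metis mod_eq_dvd_iff)
      with d show False by simp
    qed
    then have "I_set (circulant_1k k) C u - I_set (circulant_1k k) C v \<noteq> {}"
      using si uv by (simp add: self_identifying_def V)
    then obtain e where e: "e \<in> {0, -1, 1, int k}" "(u + e) mod n \<in> C"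
      "\<forall>f\<in>{0, -1, 1, int k}. \<not> n dvd (u + e) - (v + f)"
      using I_set_diff_empty_iff[of u k v C] uv unfolding n_def by blast
    have "(u + e) mod n = (x + e) mod n" by (simp add: u_def mod_simps)
    moreover have "n dvd (u + e) - (v + f) \<longleftrightarrow> n dvd e - d - f" for f
    proof -
      have "n dvd (u + e) - (v + f) \<longleftrightarrow> (u + e) mod n = (v + f) mod n"
        by (simp add: mod_eq_dvd_iff)
      also have "\<dots> \<longleftrightarrow> (x + e) mod n = (x + d + f) mod n"
        by (simp add: u_def v_def mod_simps)
      also have "\<dots> \<longleftrightarrow> n dvd e - d - f" by (simp add: mod_eq_dvd_iff algebra_simps)
      finally show ?thesis .
    qed
    ultimately show ?thesis using e by (intro bexI[of _ e]) auto
  qed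
  have nd: "\<not> n dvd 1" "\<not> n dvd int k" "\<not> n dvd int k + 1"
    using k by (auto simp: n_def dest!: zdvd_imp_le)
  have n2: "n = 2 * int k" by (simp add: n_def)
  \<comment> \<open>The closed neighbourhoods of \<open>x + 1\<close> and \<open>x + 1 + d\<close>
    share two vertices for each of \<open>d = k + 1\<close>, \<open>k\<close>, \<open>1\<close>. The
    codeword that separates them must be one of the two vertices left over.\<close>
  have c1: "x mod n \<in> C \<or> (x + 1) mod n \<in> C" for x
    using key[of "int k + 1" "x + 1"] nd by (auto simp: n2)
  have c2: "x mod n \<in> C \<or> (x + 2) mod n \<in> C" for x
    using key[of "int k" "x + 1"] nd by (auto simp: n2 add.commute)
  have c3: "x mod n \<in> C \<or> (x + int k + 1) mod n \<in> C" for x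
    using key[of 1 "x + 1"] nd by (auto simp: n2 algebra_simps)
  show ?thesis unfolding spread_def n_def[symmetric] using c1 c2 c3 by (auto simp: n2[symmetric])
qed

lemma spread_imp_self_identifying:
  assumes k: "k \<ge> 4" and CV: "C \<subseteq> {0..<2 * int k}"
    and sp: "spread (int k) (\<lambda>x. x mod (2 * int k) \<notin> C)"
  shows "self_identifying (circulant_1k k) C"
proof -
  define n where "n = 2 * int k"
  have V: "pverts (circulant_1k k) = {0..<n}" by (simp add: circulant_1k_def n_def)
  have c1: "x mod n \<in> C \<or> (x + 1) mod n \<in> C"
   and c2: "x mod n \<in> C \<or> (x + 2) mod n \<in> C"
   and c3: "x mod n \<in> C \<or> (x + int k + 1) mod n \<in> C" for x
    using sp by (auto simp: spread_def n_def)
  have ne: "C \<noteq> {}" using c1[of 0] by auto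
  have "I_set (circulant_1k k) C u - I_set (circulant_1k k) C v \<noteq> {}"
    if u: "u \<in> {0..<n}" and v: "v \<in> {0..<n}" and uv: "u \<noteq> v" for u v
  proof
    assume "I_set (circulant_1k k) C u - I_set (circulant_1k k) C v = {}"
    then have sub: "\<exists>f\<in>{0, -1, 1, int k}. n dvd (u + e) - (v + f)"
      if "e \<in> {0, -1, 1, int k}" "(u + e) mod n \<in> C" for e
      using I_set_diff_empty_iff[of u k v C] u v that unfolding n_def by blast
    define d where "d = u - v"
    have d: "d \<noteq> 0" "- n < d" "d < n" using u v uv by (auto simp: d_def)
    have near: "\<exists>f\<in>{0, -1, 1, int k}. d + e - f = 0 \<or> d + e - f = n \<or> d + e - f = - n"
      if e: "e \<in> {0, -1, 1, int k}" "(u + e) mod n \<in> C" for e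
    proof -
      obtain f where f: "f \<in> {0, -1, 1, int k}" "n dvd (u + e) - (v + f)" using sub[OF e] by blast
      have "(u + e) - (v + f) = d + e - f" by (simp add: d_def)
      with f have "n dvd d + e - f" by metis
      moreover have "\<bar>d + e - f\<bar> < 2 * n" using e(1) f(1) d k by (auto simp: n_def)
      ultimately show ?thesis using f(1) dvd_small_int by blast
    qed
    \<comment> \<open>The facts \<open>a1\<close> to \<open>a4\<close> list the offsets
      \<open>d\<close> for which a codeword at \<open>u + 1\<close>, \<open>u - 1\<close>,
      \<open>u\<close> or \<open>u + k\<close> also lies in the closed neighbourhood of
      \<open>v\<close>.\<close>
    have k': "int k \<ge> 4" using k by simp
    have a1: "d + 1 = 0 \<or> d + 2 = 0 \<or> d + 1 = int k \<or> d + 1 = n \<or> d + 2 = n \<or> d + 1 = - int k"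
      if "(u + 1) mod n \<in> C"
      using near[of 1] that d k' by (auto simp: n_def)
    have a2: "d = 1 \<or> d = 2 \<or> d = int k + 1 \<or> d = 1 - n \<or> d = 2 - n \<or> d = 1 - int k"
      if "(u - 1) mod n \<in> C"
      using near[of "-1"] that d k' by (auto simp: n_def)
    have a3: "d = 1 \<or> d = -1 \<or> d = int k \<or> d = - int k \<or> d = 1 - n \<or> d = n - 1"
      if "u mod n \<in> C"
      using near[of 0] that d k' by (auto simp: n_def)
    have a4: "d = int k \<or> d = - int k \<or> d = 1 - int k \<or> d = int k + 1 \<or> d = int k - 1 \<or> d = - int k - 1"
      if "(u + int k) mod n \<in> C"
      using near[of "int k"] that d k' by (auto simp: n_def)
    have per: "(u + 1 + int k + int k) mod n = (u + 1) mod n"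
    proof -
      have "u + 1 + int k + int k = (u + 1) + n" by (simp add: n_def)
      then show ?thesis by (simp only: mod_add_self2)
    qed
    \<comment> \<open>At most one of \<open>u - 1\<close>, \<open>u\<close>, \<open>u + 1\<close> is
      outside \<open>C\<close>. If it is \<open>u - 1\<close> or \<open>u + 1\<close>, then
      \<open>u + k\<close> lies in \<open>C\<close>, because the two differ by \<open>k + 1\<close>
      modulo \<open>n\<close> in one order or the other.\<close>
    consider "(u - 1) mod n \<in> C" "(u + 1) mod n \<in> C"
      | "u mod n \<in> C" "(u + 1) mod n \<in> C" "(u + int k) mod n \<in> C"
      | "u mod n \<in> C" "(u - 1) mod n \<in> C" "(u + int k) mod n \<in> C"
      using c1[of u] c1[of "u - 1"] c2[of "u - 1"] c3[of "u - 1"] c3[of "u + int k"] per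
      by (auto simp: algebra_simps)
    then show False
    proof cases
      case 1
      \<comment> \<open>The two lists of offsets are disjoint for \<open>k \<ge> 4\<close>; for
        \<open>k = 3\<close> they would share \<open>d = 2\<close>.\<close>
      show False using a1[OF 1(2)] a2[OF 1(1)] k' unfolding n_def by (elim disjE; linarith)
    next
      case 2
      show False using a1[OF 2(2)] a3[OF 2(1)] a4[OF 2(3)] k' unfolding n_def by (elim disjE; linarith)
    next
      case 3
      show False using a2[OF 3(2)] a3[OF 3(1)] a4[OF 3(3)] k' unfolding n_def by (elim disjE; linarith)
    qed
  qed
  then show ?thesis using CV ne by (auto simp: self_identifying_def is_code_def V n_def)
qed

subsection \<open>Maximum size of a spread set\<close>

text \<open>Allows the cycle to be cut at any vertex: reduction modulo \<open>n\<close> maps every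
  window of length \<open>n\<close> bijectively onto the residues.\<close>

lemma card_window_periodic:
  fixes n a :: int and P :: "int \<Rightarrow> bool"
  assumes n: "n > 0" and per: "\<And>x. P (x mod n) = P x"
  shows "card {x\<in>{a..<a + n}. P x} = card {x\<in>{0..<n}. P x}"
proof -
  have "bij_betw (\<lambda>x. x mod n) {x\<in>{a..<a + n}. P x} {x\<in>{0..<n}. P x}"
    unfolding bij_betw_def
  proof
    show "inj_on (\<lambda>x. x mod n) {x\<in>{a..<a + n}. P x}"
    proof (rule inj_onI)
      fix x y assume x: "x \<in> {x\<in>{a..<a + n}. P x}" and y: "y \<in> {x\<in>{a..<a + n}. P x}"
        and "x mod n = y mod n"
      then have "n dvd x - y" by (simp add: mod_eq_dvd_iff)
      then show "x = y" using x y dvd_small_int[of n "x - y"] by auto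
    qed
    show "(\<lambda>x. x mod n) ` {x\<in>{a..<a + n}. P x} = {x\<in>{0..<n}. P x}"
    proof (intro equalityI subsetI)
      fix y assume y: "y \<in> {x\<in>{0..<n}. P x}"
      define x where "x = a + (y - a) mod n"
      have "x mod n = y" using y by (simp add: x_def mod_simps)
      moreover have "x \<in> {a..<a + n}" using n by (simp add: x_def)
      moreover have "P x" using per[of x] y \<open>x mod n = y\<close> by simp
      ultimately show "y \<in> (\<lambda>x. x mod n) ` {x\<in>{a..<a + n}. P x}" by blast
    qed (use n per in auto)
  qed
  then show ?thesis by (rule bij_betw_same_card)
qed

lemma finite_int_window: "finite {x\<in>{a..<b::int}. P x}"
  by (rule finite_subset[of _ "{a..<b}"]) auto

lemma card_window_split:
  fixes a b c :: int
  assumes "a \<le> b" "b \<le> c"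
  shows "card {x\<in>{a..<c}. P x} = card {x\<in>{a..<b}. P x} + card {x\<in>{b..<c}. P x}"
proof -
  have "{x\<in>{a..<c}. P x} = {x\<in>{a..<b}. P x} \<union> {x\<in>{b..<c}. P x}" using assms by auto
  moreover have "{x\<in>{a..<b}. P x} \<inter> {x\<in>{b..<c}. P x} = {}" by auto
  ultimately show ?thesis using finite_int_window by (simp only: card_Un_disjoint)
qed

lemma spread_periodic:
  assumes "spread k P"
  shows "P (x mod (2 * k)) = P x"
proof -
  have "P (x + 2 * k * int j) = P x" for x j
  proof (induction j)
    case (Suc j)
    have "x + 2 * k * int (Suc j) = (x + 2 * k * int j) + 2 * k" by (simp add: algebra_simps)
    then show ?case using assms Suc by (metis spread_def)
  qed simp
  \<comment> \<open>A shift by a negative multiple is undone by a nonnegative one.\<close>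
  then have "P (x + 2 * k * q) = P x" for x q
    by (cases q rule: int_cases2) (simp, metis add.commute diff_add_cancel mult_minus_right uminus_add_conv_diff)
  from this[of "x mod (2 * k)" "x div (2 * k)"] show ?thesis by (simp add: mod_mult_div_eq)
qed

lemma card_window_le_one:
  assumes sp: "spread k P" and "b \<le> a + 3"
  shows "card {x\<in>{a..<b}. P x} \<le> 1"
proof -
  have "x = y" if "x \<in> {a..<b}" "y \<in> {a..<b}" "P x" "P y" for x y
  proof -
    have "y = x \<or> y = x + 1 \<or> y = x + 2 \<or> x = y + 1 \<or> x = y + 2" using that assms(2) by auto
    then show ?thesis using sp that(3,4) by (auto simp: spread_def)
  qed
  then have "card {x\<in>{a..<b}. P x} \<le> Suc 0"
    by (subst card_le_Suc0_iff_eq[OF finite_int_window]) blast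
  then show ?thesis by simp
qed

lemma card_window_le_third:
  assumes sp: "spread k P"
  shows "card {x\<in>{a..<a + 3 * int j}. P x} \<le> j"
proof (induction j)
  case (Suc j)
  have "card {x\<in>{a..<a + 3 * int (Suc j)}. P x} =
      card {x\<in>{a..<a + 3 * int j}. P x} + card {x\<in>{a + 3 * int j..<a + 3 * int (Suc j)}. P x}"
    by (rule card_window_split) auto
  moreover have "card {x\<in>{a + 3 * int j..<a + 3 * int (Suc j)}. P x} \<le> 1"
    by (rule card_window_le_one[OF sp]) simp
  ultimately show ?case using Suc by linarith
qed simp

text \<open>Here \<open>2 * k = 6 * m + 4\<close>, so counting in threes alone would allow
  \<open>2 * m + 1\<close>. Excluding that value needs the forbidden difference
  \<open>k + 1 = 3 * (m + 1)\<close>.\<close>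

lemma spread_card_le_of_residue_2:
  assumes k: "k = 3 * m + 2" and m: "m \<ge> 1" and sp: "spread (int k) P"
  shows "card {x\<in>{0..<2 * int k}. P x} \<le> 2 * m"
proof (rule ccontr)
  assume "\<not> ?thesis"
  then have big: "card {x\<in>{a..<a + 2 * int k}. P x} \<ge> 2 * m + 1" for a
    using card_window_periodic[of "2 * int k" P a] spread_periodic[OF sp] m k by simp
  have gap: "\<not> (P x \<and> P (x + 3 * int (m + 1)))" for x
    using sp k by (auto simp: spread_def algebra_simps)
  show False
  proof (cases "\<exists>x. \<not> P (x - 3) \<and> \<not> P (x - 2) \<and> \<not> P (x - 1)")
    case True
    then obtain x where x: "\<not> P (x - 3)" "\<not> P (x - 2)" "\<not> P (x - 1)" by blast
    have per: "P (y + 2 * int k) = P y" for y using sp by (simp add: spread_def)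
    \<comment> \<open>If \<open>x + 3 * j\<close> were missing, the period starting at
      \<open>x\<close> would split into \<open>3 * j\<close> positions, the missing one,
      \<open>3 * (2 * m - j)\<close> positions, and a copy of the empty triple. That leaves room for
      only \<open>2 * m\<close> elements.\<close>
    have "P (x + 3 * int j)" if j: "j \<le> 2 * m" for j
    proof (rule ccontr)
      assume nj: "\<not> ?thesis"
      let ?a = "x + 3 * int j" let ?b = "x + 6 * int m + 1" let ?c = "x + 2 * int k"
      have "card {y\<in>{x..<?c}. P y} = card {y\<in>{x..<?a}. P y} + card {y\<in>{?a..<?c}. P y}"
        by (rule card_window_split) (use j k in auto)
      moreover have "card {y\<in>{?a..<?c}. P y} = card {y\<in>{?a..<?a + 1}. P y} + card {y\<in>{?a + 1..<?c}. P y}"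
        by (rule card_window_split) (use j k in auto)
      moreover have "card {y\<in>{?a + 1..<?c}. P y} = card {y\<in>{?a + 1..<?b}. P y} + card {y\<in>{?b..<?c}. P y}"
        by (rule card_window_split) (use j k in auto)
      moreover have "card {y\<in>{?a..<?a + 1}. P y} = 0"
      proof -
        have "y = ?a" if "y \<in> {?a..<?a + 1}" for y using that by auto
        then have "{y\<in>{?a..<?a + 1}. P y} = {}" using nj by blast
        then show ?thesis by (simp only: card.empty)
      qed
      moreover have "card {y\<in>{?b..<?c}. P y} = 0"
      proof -
        have "\<not> P y" if "y \<in> {?b..<?c}" for y
        proof -
          have "y = (x - 3) + 2 * int k \<or> y = (x - 2) + 2 * int k \<or> y = (x - 1) + 2 * int k"
            using that k by auto
          then show ?thesis using x per by metis
        qed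
        then have "{y\<in>{?b..<?c}. P y} = {}" by blast
        then show ?thesis by (simp only: card.empty)
      qed
      moreover have "card {y\<in>{x..<?a}. P y} \<le> j" by (rule card_window_le_third[OF sp])
      moreover have "card {y\<in>{?a + 1..<?b}. P y} \<le> 2 * m - j"
      proof -
        have "?b = ?a + 1 + 3 * int (2 * m - j)" using j by (simp add: of_nat_diff)
        then show ?thesis by (simp only: card_window_le_third[OF sp])
      qed
      ultimately have "card {y\<in>{x..<?c}. P y} \<le> 2 * m" using j by linarith
      with big[of x] show False by simp
    qed
    \<comment> \<open>The index \<open>m + 1\<close> is in range because
      \<open>m \<ge> 1\<close>.\<close>
    from this[of 0] this[of "m + 1"] m gap[of x] show False by auto
  next
    case False
    have "{x\<in>{0..<0 + 2 * int k}. P x} \<noteq> {}"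
      using big[of 0] by (metis card.empty not_one_le_zero add_leE)
    then obtain a where a: "P a" by blast
    have "P (a + 3 * int j)" for j
    proof (induction j)
      case (Suc j)
      let ?y = "a + 3 * int j"
      have "\<not> P (?y + 1)" "\<not> P (?y + 2)" using Suc sp by (auto simp: spread_def)
      \<comment> \<open>No triple is empty; the one ending just before \<open>?y + 4\<close> must
        therefore meet \<open>P\<close>, and only \<open>?y + 3\<close> remains.\<close>
      moreover have "P (?y + 1) \<or> P (?y + 2) \<or> P (?y + 3)"
        using False by (drule_tac not_ex[THEN iffD1]) (auto dest: spec[of _ "?y + 4"] simp: algebra_simps)
      ultimately show ?case by (simp add: algebra_simps)
    qed (use a in simp)
    with a gap[of a] show False by blast
  qed
qed

lemma spread_card_le:
  assumes k: "k \<ge> 3" and sp: "spread (int k) P"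
  shows "card {x\<in>{0..<2 * int k}. P x} \<le> 2 * (k div 3)"
proof (cases "k mod 3 = 2")
  case True
  then have "k = 3 * (k div 3) + 2" by presburger
  moreover have "k div 3 \<ge> 1" using k by simp
  ultimately show ?thesis using spread_card_le_of_residue_2 sp by blast
next
  case False
  define m where "m = k div 3"
  have km: "k = 3 * m \<or> k = 3 * m + 1" using False unfolding m_def by presburger
  show ?thesis
  proof (cases "\<exists>x. P x")
    case False
    then show ?thesis by simp
  next
    case True
    then obtain x where x: "P x" by blast
    have per: "P (y + 2 * int k) = P y" for y using sp by (simp add: spread_def)
    let ?b = "x + 3 * int (2 * m)" let ?c = "x + 2 * int k"
    have "card {y\<in>{x..<?c}. P y} = card {y\<in>{x..<?b}. P y} + card {y\<in>{?b..<?c}. P y}"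
      by (rule card_window_split) (use km in auto)
    \<comment> \<open>These are the last \<open>0\<close> or \<open>2\<close> positions before
      \<open>x + 2 * k\<close>, a copy of the element \<open>x\<close>, so they are too close to it
      to satisfy \<open>P\<close>.\<close>
    moreover have "{y\<in>{?b..<?c}. P y} = {}"
    proof -
      have "\<not> P y" if "y \<in> {?b..<?c}" for y
      proof
        assume y: "P y"
        have "x + 2 * int k = y + 1 \<or> x + 2 * int k = y + 2" using that km by auto
        then have "P (y + 1) \<or> P (y + 2)" using x per by metis
        then show False using y sp by (auto simp: spread_def)
      qed
      then show ?thesis by blast
    qed
    moreover have "card {y\<in>{x..<?b}. P y} \<le> 2 * m" by (rule card_window_le_third[OF sp])
    moreover have "card {y\<in>{x..<?c}. P y} = card {y\<in>{0..<2 * int k}. P y}"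
      by (rule card_window_periodic) (use k spread_periodic[OF sp] in auto)
    ultimately show ?thesis unfolding m_def by (metis add_0_right card.empty)
  qed
qed

text \<open>The witness has period \<open>k\<close>, which reduces the forbidden difference
  \<open>k + 1\<close> to the difference \<open>1\<close>.\<close>

lemma spread_max_exists:
  assumes k: "k \<ge> 3"
  obtains P where "spread (int k) P" "card {x\<in>{0..<2 * int k}. P x} = 2 * (k div 3)"
proof -
  define m where "m = int (k div 3)"
  define P where "P x \<longleftrightarrow> x mod int k < 3 * m \<and> 3 dvd x mod int k" for x
  have mk: "3 * m \<le> int k" "m \<ge> 1" using k by (auto simp: m_def)
  have kpos: "int k > 0" using k by simp
  have step: "\<not> P (x + e)" if x: "P x" and e: "e = 1 \<or> e = 2" for x e
  proof -
    define r where "r = x mod int k"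
    have r: "3 dvd r" "0 \<le> r" "r < 3 * m" using x kpos by (auto simp: P_def r_def)
    \<comment> \<open>Both \<open>r\<close> and \<open>3 * m\<close> are multiples of
      \<open>3\<close>; hence adding \<open>1\<close> or \<open>2\<close> to \<open>r\<close> does
      not wrap around modulo \<open>k\<close>.\<close>
    have "r + 3 \<le> 3 * m" using r by presburger
    then have "(r + e) mod int k = r + e" using r e mk by (intro mod_pos_pos_trivial) auto
    moreover have "(r + e) mod int k = (x + e) mod int k" by (simp add: r_def mod_simps)
    moreover have "\<not> 3 dvd r + e" using r(1) e by presburger
    ultimately show ?thesis by (simp add: P_def)
  qed
  have per: "P (x + int k) = P x" for x by (simp add: P_def)
  have "spread (int k) P"
    unfolding spread_def
  proof (intro conjI allI impI)
    fix x
    show "P (x + 2 * int k) = P x" using per[of x] per[of "x + int k"] by (simp add: algebra_simps)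
    assume x: "P x"
    show "\<not> P (x + 1)" "\<not> P (x + 2)" using step[OF x] by auto
    show "\<not> P (x + int k + 1)" using step[OF x, of 1] per[of "x + 1"] by (simp add: algebra_simps)
  qed
  moreover have "card {x\<in>{0..<2 * int k}. P x} = 2 * (k div 3)"
  proof -
    let ?A = "{x\<in>{0..<int k}. P x}"
    have "bij_betw (\<lambda>j. 3 * int j) {..<k div 3} ?A"
      unfolding bij_betw_def
    proof
      show "(\<lambda>j. 3 * int j) ` {..<k div 3} = ?A"
      proof (intro equalityI subsetI)
        fix y assume "y \<in> (\<lambda>j. 3 * int j) ` {..<k div 3}"
        then obtain j where j: "j < k div 3" "y = 3 * int j" by auto
        then have "y < 3 * m" by (simp add: m_def)
        then show "y \<in> ?A" using j mk by (simp add: P_def)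
      next
        fix y assume y: "y \<in> ?A"
        then have "3 dvd y" "y < 3 * m" "0 \<le> y" by (auto simp: P_def)
        then obtain q where "y = 3 * q" by (elim dvdE)
        with \<open>y < 3 * m\<close> \<open>0 \<le> y\<close> have "y = 3 * int (nat q)" "nat q < k div 3" by (auto simp: m_def)
        then show "y \<in> (\<lambda>j. 3 * int j) ` {..<k div 3}" by blast
      qed
    qed (simp add: inj_on_def)
    then have A: "card ?A = k div 3" using bij_betw_same_card by fastforce
    have "card {x\<in>{int k..<int k + int k}. P x} = card ?A"
      by (rule card_window_periodic) (use k in \<open>auto simp: P_def\<close>)
    moreover have "card {x\<in>{0..<2 * int k}. P x} = card ?A + card {x\<in>{int k..<2 * int k}. P x}"
      by (rule card_window_split) auto
    moreover have "int k + int k = 2 * int k" by simp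
    ultimately show ?thesis using A by (metis mult_2)
  qed
  ultimately show ?thesis using that by blast
qed

subsection \<open>The minimum cardinality\<close>

text \<open>Complementation exchanges smallest codes with largest spread sets, giving one closed
  form for all residues of \<open>k\<close> modulo \<open>3\<close>.\<close>

lemma gamma_SID_circulant_1k:
  assumes k: "k \<ge> 4"
  shows "gamma_SID (circulant_1k k) = 2 * k - 2 * (k div 3)"
proof -
  let ?V = "{0..<2 * int k}"
  have sub: "C \<subseteq> ?V" if "self_identifying (circulant_1k k) C" for C
    using that by (simp add: self_identifying_def is_code_def circulant_1k_def)
  have "{card C |C. self_identifying (circulant_1k k) C} \<subseteq> card ` Pow ?V" using sub by blast
  then have fin: "finite {card C |C. self_identifying (circulant_1k k) C}"
    by (rule finite_subset) simp
  have lower: "2 * k - 2 * (k div 3) \<le> card C" if C: "self_identifying (circulant_1k k) C" for C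
  proof -
    have "{x\<in>?V. x mod (2 * int k) \<notin> C} = ?V - C" by auto
    then have "card (?V - C) \<le> 2 * (k div 3)"
      using spread_card_le[OF _ self_identifying_imp_spread[OF _ C]] k by simp
    moreover have "card (?V - C) = 2 * k - card C"
      using sub[OF C] by (subst card_Diff_subset) (auto intro: finite_subset)
    ultimately show ?thesis by linarith
  qed
  obtain P where P: "spread (int k) P" "card {x\<in>?V. P x} = 2 * (k div 3)"
    using spread_max_exists[of k] k by auto
  define C where "C = ?V - {x\<in>?V. P x}"
  have "(\<lambda>x. x mod (2 * int k) \<notin> C) = P"
    using spread_periodic[OF P(1)] k by (auto simp: C_def fun_eq_iff)
  then have "self_identifying (circulant_1k k) C"
    using spread_imp_self_identifying[of k C] k P(1) by (auto simp: C_def)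
  moreover have "card C = 2 * k - 2 * (k div 3)"
  proof -
    have "card C = card ?V - card {x\<in>?V. P x}"
      unfolding C_def by (rule card_Diff_subset[OF finite_int_window]) auto
    then show ?thesis using P(2) by simp
  qed
  ultimately show ?thesis
    unfolding gamma_SID_def using lower fin by (intro Min_eqI) (auto, metis)
qed

theorem theorem10:
  fixes k :: nat
  assumes "k \<ge> 5"
  shows "int (gamma_SID (circulant_1k k)) =
    (if k mod 3 = 0 \<or> k mod 3 = 1 then \<lceil>4 * real k / 3\<rceil> else \<lceil>4 * real k / 3\<rceil> + 1)"
proof -
  define m where "m = k div 3"
  have G: "gamma_SID (circulant_1k k) = 2 * k - 2 * m"
    using gamma_SID_circulant_1k assms by (simp add: m_def)
  have "k mod 3 < 3" by simp
  then consider "k mod 3 = 0" | "k mod 3 = 1" | "k mod 3 = 2" by linarith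
  \<comment> \<open>For \<open>k = 3 * m + r\<close> the closed form is
    \<open>4 * m + 2 * r\<close>, while \<open>4 * k / 3\<close> is
    \<open>4 * m + 4 * r / 3\<close>. Its ceiling falls short by one exactly when
    \<open>r = 2\<close>.\<close>
  then show ?thesis
  proof cases
    case 1
    then have k: "k = 3 * m" unfolding m_def by presburger
    have "\<lceil>4 * real k / 3\<rceil> = 4 * int m" by (rule ceiling_unique) (auto simp: k)
    then show ?thesis using G 1 k by simp
  next
    case 2
    then have k: "k = 3 * m + 1" unfolding m_def by presburger
    have "\<lceil>4 * real k / 3\<rceil> = 4 * int m + 2" by (rule ceiling_unique) (auto simp: k field_simps)
    then show ?thesis using G 2 k by simp
  next
    case 3
    then have k: "k = 3 * m + 2" unfolding m_def by presburger
    have "\<lceil>4 * real k / 3\<rceil> = 4 * int m + 3" by (rule ceiling_unique) (auto simp: k field_simps)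
    then show ?thesis using G 3 k by simp
  qed
qed

end
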